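(* A $C^2$ regular spacelike curve $\alpha:I\to\mathbb{E}_1^3$, parametrized by arc-length, lies on a light-cone $\mathcal{C}^2(P)$ for some point $P$ (i.e., on a sphere of zero radius) if and only if its normal development, i.e. the curve $(\kappa_1(s),\kappa_2(s))$, lies on a line of the form $\{a_1X+ a_1Y+1=0\}$ or $\{a_1X-a_1Y+1=0\}$ ($a_1$ constant) not passing through the origin.
   Context: $\mathbb{E}_1^3$ is $\mathbb{R}^3$ with the index 1 inner product $\langle x,y\rangle_1=x_1y_1+x_2y_2-x_3y_3$. A curve is spacelike if $\langle\alpha',\alpha'\rangle_1>0$; arc-length means $\langle\alpha',\alpha'\rangle_1=1$. Light-cone: $\mathcal{C}^2(P)=\{x\in\mathbb{E}_1^3:\langle x-P,x-P\rangle_1=0\}$. Let $\mathbf t=\alpha'$. A rotation minimizing (RM) frame $\{\mathbf t,\mathbf n_1,\mathbf n_2\}$ along a spacelike curve is an orthonormal frame with $\langle\mathbf n_1,\mathbf n_1\rangle_1=-1$, $\langle\mathbf n_2,\mathbf n_2\rangle_1=1$, and $\mathbf n_i'$ parallel to $\mathbf t$. Setting $\kappa_i=\langle\mathbf t',\mathbf n_i\rangle_1$, one has $\mathbf t'=-\kappa_1\mathbf n_1+\kappa_2\mathbf n_2$ and $\mathbf n_i'=-\kappa_i\mathbf t$. The normal development is the plane curve $(\kappa_1,\kappa_2)$, in coordinates $(X,Y)$. *)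

theory Defs
  imports "HOL-Analysis.Analysis"
begin

definition lorentz :: "real^3 \<Rightarrow> real^3 \<Rightarrow> real" where
  "lorentz x y = x$1 * y$1 + x$2 * y$2 - x$3 * y$3"

definition light_cone :: "real^3 \<Rightarrow> (real^3) set" where
  "light_cone P = {x. lorentz (x - P) (x - P) = 0}"

text \<open>
  Curves are functions on the whole real line of which only the values on an interval \<open>I\<close> matter.
  All derivatives are taken within \<open>I\<close>, so they are one-sided at endpoints belonging to \<open>I\<close>; they
  are uniquely determined when \<open>I\<close> has nonempty interior.
\<close>

definition C1_on :: "real set \<Rightarrow> (real \<Rightarrow> real^3) \<Rightarrow> bool" where
  "C1_on I f \<longleftrightarrow>
     (\<forall>s\<in>I. f differentiable (at s within I)) \<and>
     continuous_on I (\<lambda>s. vector_derivative f (at s within I))"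

definition tangent :: "real set \<Rightarrow> (real \<Rightarrow> real^3) \<Rightarrow> real \<Rightarrow> real^3" where
  "tangent I \<alpha> s = vector_derivative \<alpha> (at s within I)"

definition C2_on :: "real set \<Rightarrow> (real \<Rightarrow> real^3) \<Rightarrow> bool" where
  "C2_on I \<alpha> \<longleftrightarrow> C1_on I \<alpha> \<and> C1_on I (tangent I \<alpha>)"

definition regular_on :: "real set \<Rightarrow> (real \<Rightarrow> real^3) \<Rightarrow> bool" where
  "regular_on I \<alpha> \<longleftrightarrow> (\<forall>s\<in>I. tangent I \<alpha> s \<noteq> 0)"

definition spacelike_on :: "real set \<Rightarrow> (real \<Rightarrow> real^3) \<Rightarrow> bool" where
  "spacelike_on I \<alpha> \<longleftrightarrow> (\<forall>s\<in>I. lorentz (tangent I \<alpha> s) (tangent I \<alpha> s) > 0)"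

definition arc_length_on :: "real set \<Rightarrow> (real \<Rightarrow> real^3) \<Rightarrow> bool" where
  "arc_length_on I \<alpha> \<longleftrightarrow> (\<forall>s\<in>I. lorentz (tangent I \<alpha> s) (tangent I \<alpha> s) = 1)"

definition rm_frame ::
  "real set \<Rightarrow> (real \<Rightarrow> real^3) \<Rightarrow> (real \<Rightarrow> real^3) \<Rightarrow> (real \<Rightarrow> real^3) \<Rightarrow> bool" where
  "rm_frame I \<alpha> n1 n2 \<longleftrightarrow>
     (\<forall>s\<in>I.
        lorentz (tangent I \<alpha> s) (tangent I \<alpha> s) = 1 \<and>
        lorentz (n1 s) (n1 s) = -1 \<and>
        lorentz (n2 s) (n2 s) = 1 \<and>
        lorentz (tangent I \<alpha> s) (n1 s) = 0 \<and>
        lorentz (tangent I \<alpha> s) (n2 s) = 0 \<and>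
        lorentz (n1 s) (n2 s) = 0 \<and>
        (\<exists>c. (n1 has_vector_derivative c *\<^sub>R tangent I \<alpha> s) (at s within I)) \<and>
        (\<exists>c. (n2 has_vector_derivative c *\<^sub>R tangent I \<alpha> s) (at s within I)))"

definition rm_curvature ::
  "real set \<Rightarrow> (real \<Rightarrow> real^3) \<Rightarrow> (real \<Rightarrow> real^3) \<Rightarrow> real \<Rightarrow> real" where
  "rm_curvature I \<alpha> n s = lorentz (vector_derivative (tangent I \<alpha>) (at s within I)) (n s)"

definition normal_development ::
  "real set \<Rightarrow> (real \<Rightarrow> real^3) \<Rightarrow> (real \<Rightarrow> real^3) \<Rightarrow> (real \<Rightarrow> real^3) \<Rightarrow> real \<Rightarrow> real \<times> real" where
  "normal_development I \<alpha> n1 n2 s = (rm_curvature I \<alpha> n1 s, rm_curvature I \<alpha> n2 s)"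

end

theory Submission
  imports Defs
begin

text \<open>
  Along a rotation minimizing frame the normal vector fields move only in the tangent direction.
  Hence the components of \<open>\<alpha> - P\<close> along \<open>n1\<close> and \<open>n2\<close> have derivative zero as soon as
  \<open>\<alpha> - P\<close> is orthogonal to the tangent, and for constants \<open>A\<close>, \<open>B\<close> the derivative of
  \<open>\<alpha> - A n1 - B n2\<close> is \<open>(1 + A \<kappa>1 + B \<kappa>2) t\<close>.

  If \<open>\<alpha>\<close> lies on the light-cone of \<open>P\<close>, differentiating \<open>\<langle>\<alpha> - P, \<alpha> - P\<rangle> = 0\<close> once shows that
  \<open>\<alpha> - P\<close> is orthogonal to \<open>t\<close>, so it equals \<open>A n1 + B n2\<close> with constant \<open>A\<close>, \<open>B\<close>
  (\<open>light_cone_normal_coefficients\<close>). Differentiating again gives \<open>A \<kappa>1 + B \<kappa>2 + 1 = 0\<close>, a line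
  that misses the origin. Conversely, such a line makes the point \<open>\<alpha> - A n1 - B n2\<close> independent of
  the parameter (\<open>rm_frame_centre_constant\<close>), and this point is the vertex \<open>P\<close>. In both directions
  \<open>\<langle>\<alpha> - P, \<alpha> - P\<rangle> = B\<^sup>2 - A\<^sup>2\<close>, because \<open>n1\<close> is timelike and \<open>n2\<close> spacelike; it vanishes exactly
  when \<open>B = A\<close> or \<open>B = - A\<close>, and these two cases are the two families of lines.
\<close>

section \<open>The Lorentzian inner product\<close>

lemma lorentz_commute: "lorentz x y = lorentz y x"
  by (simp add: lorentz_def)

lemma bounded_bilinear_lorentz: "bounded_bilinear lorentz"
proof -
  have "bilinear lorentz"
    unfolding bilinear_def lorentz_def
    by (auto intro!: linearI simp: algebra_simps)
  then show ?thesis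
    by (simp add: bilinear_conv_bounded_bilinear)
qed

lemmas lorentz_simps =
  bounded_bilinear.add_left [OF bounded_bilinear_lorentz]
  bounded_bilinear.add_right [OF bounded_bilinear_lorentz]
  bounded_bilinear.diff_left [OF bounded_bilinear_lorentz]
  bounded_bilinear.diff_right [OF bounded_bilinear_lorentz]
  bounded_bilinear.scaleR_left [OF bounded_bilinear_lorentz]
  bounded_bilinear.scaleR_right [OF bounded_bilinear_lorentz]

lemmas lorentz_has_vector_derivative =
  bounded_bilinear.has_vector_derivative [OF bounded_bilinear_lorentz]

text \<open>
  The inner products with \<open>t\<close>, \<open>n1\<close>, \<open>n2\<close> recover the coefficients of a linear combination. The
  map from coefficients to combinations is therefore injective, and an injective linear
  endomorphism of a space of finite dimension is onto.
\<close>

lemma lorentz_orthonormal_expansion: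
  assumes t: "lorentz t t = 1" and n1: "lorentz n1 n1 = -1" and n2: "lorentz n2 n2 = 1"
    and orth: "lorentz t n1 = 0" "lorentz t n2 = 0" "lorentz n1 n2 = 0"
  shows "x = lorentz x t *\<^sub>R t - lorentz x n1 *\<^sub>R n1 + lorentz x n2 *\<^sub>R n2"
proof -
  define F :: "real^3 \<Rightarrow> real^3" where "F c = c$1 *\<^sub>R t + c$2 *\<^sub>R n1 + c$3 *\<^sub>R n2" for c
  have coeffs: "lorentz (F c) t = c$1" "lorentz (F c) n1 = - (c$2)" "lorentz (F c) n2 = c$3" for c
    using assms lorentz_commute [of n1 t] lorentz_commute [of n2 t] lorentz_commute [of n2 n1]
    by (simp_all add: F_def lorentz_simps)
  have "linear F"
    unfolding F_def by (auto intro!: linearI simp: algebra_simps)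
  moreover have "inj F"
  proof (rule injI)
    fix c d assume "F c = F d"
    then have "c$1 = d$1" "c$2 = d$2" "c$3 = d$3"
      using coeffs [of c] coeffs [of d] by simp_all
    then show "c = d"
      by (simp add: vec_eq_iff forall_3)
  qed
  ultimately have "surj F"
    by (rule linear_inj_imp_surj)
  then obtain c where "x = F c"
    by blast
  then show ?thesis
    using coeffs [of c] by (simp add: F_def)
qed

section \<open>Derivatives within an interval\<close>

lemma interval_at_within_nontrivial:
  fixes I :: "real set"
  assumes "is_interval I" and "interior I \<noteq> {}" and "s \<in> I"
  shows "at s within I \<noteq> bot"
proof -
  have "I \<noteq> {s}"
    using assms(2) by auto
  then have "s islimpt I"
    using assms by (intro connected_imp_perfect is_interval_connected) auto
  then show ?thesis
    by (simp add: trivial_limit_within)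
qed

text \<open>
  This also covers endpoints of the interval, where only a one-sided derivative is available.
\<close>

lemma has_vector_derivative_eq_0_if_constant_on:
  fixes f :: "real \<Rightarrow> 'a::real_normed_vector"
  assumes "is_interval I" and "interior I \<noteq> {}" and "s \<in> I"
    and "(f has_vector_derivative D) (at s within I)"
    and "\<And>u. u \<in> I \<Longrightarrow> f u = c"
  shows "D = 0"
proof -
  have "((\<lambda>_. c) has_vector_derivative D) (at s within I)"
    by (rule has_vector_derivative_transform [OF assms(3) _ assms(4)]) (simp add: assms(5))
  then show ?thesis
    using vector_derivative_unique_within [OF interval_at_within_nontrivial [OF assms(1-3)]]
      has_vector_derivative_const by blast
qed

lemma C2_on_has_vector_derivatives:
  assumes "C2_on I \<alpha>" and "s \<in> I"
  shows "(\<alpha> has_vector_derivative tangent I \<alpha> s) (at s within I)"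
    and "(tangent I \<alpha> has_vector_derivative
            vector_derivative (tangent I \<alpha>) (at s within I)) (at s within I)"
  using assms by (auto simp: C2_on_def C1_on_def tangent_def vector_derivative_works)

section \<open>Rotation minimizing frames and light-cones\<close>

text \<open>
  The multiple of \<open>t\<close> in the derivative of a normal field \<open>n\<close> is found by differentiating the
  relation \<open>\<langle>t, n\<rangle> = 0\<close>.
\<close>

lemma parallel_normal_derivative:
  assumes I: "is_interval I" "interior I \<noteq> {}" and C2: "C2_on I \<alpha>" and s: "s \<in> I"
    and unit: "lorentz (tangent I \<alpha> s) (tangent I \<alpha> s) = 1"
    and orth: "\<And>u. u \<in> I \<Longrightarrow> lorentz (tangent I \<alpha> u) (n u) = 0"
    and parallel: "\<exists>c. (n has_vector_derivative c *\<^sub>R tangent I \<alpha> s) (at s within I)"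
  shows "(n has_vector_derivative (- rm_curvature I \<alpha> n s) *\<^sub>R tangent I \<alpha> s) (at s within I)"
proof -
  obtain c where c: "(n has_vector_derivative c *\<^sub>R tangent I \<alpha> s) (at s within I)"
    using parallel by blast
  have "lorentz (tangent I \<alpha> s) (c *\<^sub>R tangent I \<alpha> s)
      + lorentz (vector_derivative (tangent I \<alpha>) (at s within I)) (n s) = 0"
    by (rule has_vector_derivative_eq_0_if_constant_on [OF I s
          lorentz_has_vector_derivative [OF C2_on_has_vector_derivatives(2) [OF C2 s] c]])
      (rule orth)
  then have "c = - rm_curvature I \<alpha> n s"
    by (simp add: lorentz_simps unit rm_curvature_def)
  then show ?thesis
    using c by simp
qed

lemma rm_frame_derivatives:
  assumes I: "is_interval I" "interior I \<noteq> {}" and C2: "C2_on I \<alpha>"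
    and rm: "rm_frame I \<alpha> n1 n2" and s: "s \<in> I"
  shows "(n1 has_vector_derivative (- rm_curvature I \<alpha> n1 s) *\<^sub>R tangent I \<alpha> s) (at s within I)"
    and "(n2 has_vector_derivative (- rm_curvature I \<alpha> n2 s) *\<^sub>R tangent I \<alpha> s) (at s within I)"
  using rm s by (intro parallel_normal_derivative [OF I C2 s]; simp add: rm_frame_def)+

text \<open>
  If \<open>x\<close> has derivative \<open>t\<close> and stays orthogonal to \<open>t\<close>, then \<open>\<langle>x, n\<rangle>\<close> has derivative
  \<open>\<langle>t, n\<rangle> + \<langle>x, k t\<rangle>\<close>, and both terms vanish.
\<close>

lemma normal_component_constant:
  assumes "is_interval I"
    and x: "\<And>s. s \<in> I \<Longrightarrow> (x has_vector_derivative t s) (at s within I)"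
    and n: "\<And>s. s \<in> I \<Longrightarrow> (n has_vector_derivative k s *\<^sub>R t s) (at s within I)"
    and orth: "\<And>s. s \<in> I \<Longrightarrow> lorentz (x s) (t s) = 0" "\<And>s. s \<in> I \<Longrightarrow> lorentz (t s) (n s) = 0"
  shows "\<exists>c. \<forall>s\<in>I. lorentz (x s) (n s) = c"
proof -
  have "((\<lambda>s. lorentz (x s) (n s)) has_vector_derivative 0) (at s within I)" if "s \<in> I" for s
    using lorentz_has_vector_derivative [OF x n, OF that that] orth [OF that]
    by (simp add: lorentz_simps)
  then obtain c where "\<And>s. s \<in> I \<Longrightarrow> lorentz (x s) (n s) = c"
    by (rule has_vector_derivative_zero_constant [OF is_interval_convex [OF assms(1)]]) blast+
  then show ?thesis
    by blast
qed

text \<open>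
  The equation of the line comes from differentiating \<open>\<langle>\<alpha> - P, \<alpha> - P\<rangle> = 0\<close> twice, which gives
  \<open>\<langle>t, t\<rangle> + \<langle>\<alpha> - P, t'\<rangle> = 0\<close>, after substituting \<open>\<alpha> - P = A n1 + B n2\<close>.
\<close>

lemma light_cone_normal_coefficients:
  assumes I: "is_interval I" "interior I \<noteq> {}" and C2: "C2_on I \<alpha>" and rm: "rm_frame I \<alpha> n1 n2"
    and cone: "\<alpha> ` I \<subseteq> light_cone P"
  obtains A B where "\<And>s. s \<in> I \<Longrightarrow> \<alpha> s - P = A *\<^sub>R n1 s + B *\<^sub>R n2 s"
    and "\<And>s. s \<in> I \<Longrightarrow> A * rm_curvature I \<alpha> n1 s + B * rm_curvature I \<alpha> n2 s + 1 = 0"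
proof -
  let ?t = "tangent I \<alpha>"
  define x where "x s = \<alpha> s - P" for s
  have frame: "lorentz (?t s) (?t s) = 1" "lorentz (n1 s) (n1 s) = -1" "lorentz (n2 s) (n2 s) = 1"
      "lorentz (?t s) (n1 s) = 0" "lorentz (?t s) (n2 s) = 0" "lorentz (n1 s) (n2 s) = 0"
    if "s \<in> I" for s
    using rm that by (auto simp: rm_frame_def)
  have dx: "(x has_vector_derivative ?t s) (at s within I)" if "s \<in> I" for s
    using C2_on_has_vector_derivatives(1) [OF C2 that]
    unfolding x_def by (auto intro!: derivative_eq_intros)
  have null: "lorentz (x s) (x s) = 0" if "s \<in> I" for s
    using cone that by (auto simp: light_cone_def x_def)
  have orth: "lorentz (x s) (?t s) = 0" if "s \<in> I" for s
    using has_vector_derivative_eq_0_if_constant_on [OF I that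
        lorentz_has_vector_derivative [OF dx dx, OF that that] null]
    by (simp add: lorentz_commute)
  have second: "lorentz (x s) (vector_derivative ?t (at s within I)) = -1" if "s \<in> I" for s
    using has_vector_derivative_eq_0_if_constant_on [OF I that lorentz_has_vector_derivative
        [OF dx C2_on_has_vector_derivatives(2) [OF C2], OF that that] orth] frame(1) [OF that]
    by simp
  obtain c1 where c1: "\<And>s. s \<in> I \<Longrightarrow> lorentz (x s) (n1 s) = c1"
    using normal_component_constant [OF I(1) dx rm_frame_derivatives(1) [OF I C2 rm] orth frame(4)]
    by auto
  obtain c2 where c2: "\<And>s. s \<in> I \<Longrightarrow> lorentz (x s) (n2 s) = c2"
    using normal_component_constant [OF I(1) dx rm_frame_derivatives(2) [OF I C2 rm] orth frame(5)]
    by auto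
  \<comment> \<open>The sign of the first coefficient comes from \<open>n1\<close> being timelike.\<close>
  have x: "x s = (- c1) *\<^sub>R n1 s + c2 *\<^sub>R n2 s" if "s \<in> I" for s
    using lorentz_orthonormal_expansion [OF frame, OF that that that that that that, of "x s"]
    by (simp add: orth c1 c2 that)
  show thesis
  proof (rule that)
    fix s assume s: "s \<in> I"
    show "\<alpha> s - P = (- c1) *\<^sub>R n1 s + c2 *\<^sub>R n2 s"
      using x [OF s] by (simp add: x_def)
    have "lorentz ((- c1) *\<^sub>R n1 s + c2 *\<^sub>R n2 s) (vector_derivative ?t (at s within I)) = -1"
      using second [OF s] by (simp only: x [OF s])
    then show "- c1 * rm_curvature I \<alpha> n1 s + c2 * rm_curvature I \<alpha> n2 s + 1 = 0"
      unfolding rm_curvature_def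
        lorentz_commute [of "vector_derivative ?t (at s within I)"] lorentz_simps
      by simp
  qed
qed

text \<open>
  The derivative of \<open>\<alpha> - A n1 - B n2\<close> is \<open>(1 + A \<kappa>1 + B \<kappa>2) t\<close>, so the equation of the line is
  exactly the condition that this point does not move.
\<close>

lemma rm_frame_centre_constant:
  assumes I: "is_interval I" "interior I \<noteq> {}" and C2: "C2_on I \<alpha>" and rm: "rm_frame I \<alpha> n1 n2"
    and line: "\<And>s. s \<in> I \<Longrightarrow> A * rm_curvature I \<alpha> n1 s + B * rm_curvature I \<alpha> n2 s + 1 = 0"
  obtains P where "\<And>s. s \<in> I \<Longrightarrow> \<alpha> s - P = A *\<^sub>R n1 s + B *\<^sub>R n2 s"
proof -
  let ?centre = "\<lambda>s. \<alpha> s - A *\<^sub>R n1 s - B *\<^sub>R n2 s"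
  have "(?centre has_vector_derivative 0) (at s within I)" if s: "s \<in> I" for s
  proof -
    let ?k1 = "rm_curvature I \<alpha> n1 s" and ?k2 = "rm_curvature I \<alpha> n2 s" and ?t = "tangent I \<alpha> s"
    have "(?centre has_vector_derivative
        ?t - A *\<^sub>R ((- ?k1) *\<^sub>R ?t) - B *\<^sub>R ((- ?k2) *\<^sub>R ?t)) (at s within I)"
      by (intro has_vector_derivative_diff C2_on_has_vector_derivatives(1) [OF C2 s]
          bounded_linear.has_vector_derivative [OF bounded_linear_scaleR_right]
          rm_frame_derivatives [OF I C2 rm s])
    also have "?t - A *\<^sub>R ((- ?k1) *\<^sub>R ?t) - B *\<^sub>R ((- ?k2) *\<^sub>R ?t) = (A * ?k1 + B * ?k2 + 1) *\<^sub>R ?t"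
      by (simp add: algebra_simps)
    finally show ?thesis
      by (simp add: line [OF s])
  qed
  then obtain P where P: "\<And>s. s \<in> I \<Longrightarrow> ?centre s = P"
    by (rule has_vector_derivative_zero_constant [OF is_interval_convex [OF I(1)]]) blast+
  show thesis
  proof (rule that)
    show "\<alpha> s - P = A *\<^sub>R n1 s + B *\<^sub>R n2 s" if "s \<in> I" for s
      using P [OF that] by (simp add: algebra_simps)
  qed
qed

lemma lorentz_normal_combination:
  assumes "rm_frame I \<alpha> n1 n2" and "s \<in> I"
  shows "lorentz (A *\<^sub>R n1 s + B *\<^sub>R n2 s) (A *\<^sub>R n1 s + B *\<^sub>R n2 s) = B\<^sup>2 - A\<^sup>2"
  using assms lorentz_commute [of "n2 s" "n1 s"]
  by (simp add: rm_frame_def lorentz_simps power2_eq_square)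

theorem theorem4p5p2:
  fixes I :: "real set" and \<alpha> n1 n2 :: "real \<Rightarrow> real^3"
  assumes "is_interval I" and "interior I \<noteq> {}"
    and "C2_on I \<alpha>" and "regular_on I \<alpha>" and "spacelike_on I \<alpha>" and "arc_length_on I \<alpha>"
    and "rm_frame I \<alpha> n1 n2"
  shows "(\<exists>P. \<alpha> ` I \<subseteq> light_cone P) \<longleftrightarrow>
    (\<exists>(a::real) L. a \<noteq> 0 \<and>
       (L = {(X, Y). a * X + a * Y + 1 = 0} \<or> L = {(X, Y). a * X - a * Y + 1 = 0}) \<and>
       (0, 0) \<notin> L \<and>
       normal_development I \<alpha> n1 n2 ` I \<subseteq> L)"
    (is "?cone \<longleftrightarrow> ?lines")
proof
  assume ?cone
  then obtain P where P: "\<alpha> ` I \<subseteq> light_cone P" ..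
  obtain A B where AB: "\<And>s. s \<in> I \<Longrightarrow> \<alpha> s - P = A *\<^sub>R n1 s + B *\<^sub>R n2 s"
    and line: "\<And>s. s \<in> I \<Longrightarrow> A * rm_curvature I \<alpha> n1 s + B * rm_curvature I \<alpha> n2 s + 1 = 0"
    using light_cone_normal_coefficients [OF assms(1-3,7) P] by blast
  obtain s where s: "s \<in> I"
    using assms(2) interior_subset by blast
  have "lorentz (\<alpha> s - P) (\<alpha> s - P) = 0"
    using P s by (auto simp: light_cone_def)
  then have "B\<^sup>2 = A\<^sup>2"
    by (simp add: AB [OF s] lorentz_normal_combination [OF assms(7) s])
  then have B: "B = A \<or> B = - A"
    by (simp add: power2_eq_iff)
  then have "A \<noteq> 0"
    using line [OF s] by auto
  from B show ?lines
  proof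
    assume "B = A"
    then have "normal_development I \<alpha> n1 n2 ` I \<subseteq> {(X, Y). A * X + A * Y + 1 = 0}"
      using line by (simp add: normal_development_def image_subset_iff)
    with \<open>A \<noteq> 0\<close> show ?thesis
      by (intro exI [of _ A] exI [of _ "{(X, Y). A * X + A * Y + 1 = 0}"]) simp
  next
    assume "B = - A"
    then have "normal_development I \<alpha> n1 n2 ` I \<subseteq> {(X, Y). A * X - A * Y + 1 = 0}"
      using line by (simp add: normal_development_def image_subset_iff)
    with \<open>A \<noteq> 0\<close> show ?thesis
      by (intro exI [of _ A] exI [of _ "{(X, Y). A * X - A * Y + 1 = 0}"]) simp
  qed
next
  assume ?lines
  then obtain A L where L: "L = {(X, Y). A * X + A * Y + 1 = 0} \<or> L = {(X, Y). A * X - A * Y + 1 = 0}"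
    and dev: "normal_development I \<alpha> n1 n2 ` I \<subseteq> L"
    by blast
  from L obtain B where B: "B = A \<or> B = - A" and "L = {(X, Y). A * X + B * Y + 1 = 0}"
    by (elim disjE) (simp_all add: that [of A] that [of "- A"])
  with dev have line: "A * rm_curvature I \<alpha> n1 s + B * rm_curvature I \<alpha> n2 s + 1 = 0" if "s \<in> I" for s
    using that by (auto simp: normal_development_def image_subset_iff)
  obtain P where P: "\<And>s. s \<in> I \<Longrightarrow> \<alpha> s - P = A *\<^sub>R n1 s + B *\<^sub>R n2 s"
    using rm_frame_centre_constant [OF assms(1-3,7) line] by blast
  \<comment> \<open>In the case \<open>B = - A\<close> the scalar \<open>- A\<close> must stay inside the scaling for the norm formula of
    normal combinations to match.\<close>
  have "\<alpha> s \<in> light_cone P" if "s \<in> I" for s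
    using B by (auto simp: light_cone_def P [OF that] lorentz_normal_combination [OF assms(7) that]
        simp del: scaleR_minus_left)
  then show ?cone
    by blast
qed

end
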